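(* The diagram $\mathbf{E}_7^{(1)}$ has exactly $2$ orbits of labelings: 1. the orbit of zero, consisting of all the labelings with $1$ or $3$ components (including the component of the boxed 1); 2. the orbit consisting of all the labelings with $2$ or $4$ components (including the component of the boxed 1), with representative the labeling with $a_2=a_4=a_6=1$ and $a_1=a_3=a_5=a_7=0$.
   Context: $\mathbf{E}_7^{(1)}$ is the Dynkin diagram $\mathbf{E}_7$ with vertices $1,\dots,7$, edges $\{1,2\},\{2,3\},\{3,4\},\{4,5\},\{5,6\},\{4,7\}$, with vertex $1$ colored black. A labeling is $\boldsymbol a=(a_1,\dots,a_7)\in(\mathbb{Z}/2\mathbb{Z})^7$. The augmented diagram is obtained by adding one extra vertex (the "boxed 1"), joined by an edge to vertex $1$ only, carrying the constant label $1$. For $1\le i\le 7$ the move $\mathcal{M}_i$ changes only $a_i$, replacing it by $a_i$ plus the sum (in $\mathbb{Z}/2\mathbb{Z}$) of the labels of all neighbors of $i$ in the augmented diagram (including the boxed 1 when $i=1$). There is no move at the boxed vertex. Orbits are the equivalence classes of labelings under finite sequences of moves. Components of a labeling are the connected components of the subgraph of the augmented diagram induced on the vertices with label $1$, the boxed vertex included. *)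

theory Defs
  imports "HOL-Library.FuncSet" "HOL-Library.Z2"
begin

text \<open>
  The Dynkin diagram \<open>E\<^sub>7\<close> has vertices \<open>1, \<dots>, 7\<close>; the natural number \<open>0\<close> stands for the
  extra ``boxed 1'' of the augmented diagram. The type \<^typ>\<open>bit\<close> is the field with two elements.
\<close>

definition E7_edges :: "nat set set" where
  "E7_edges = {{1,2}, {2,3}, {3,4}, {4,5}, {5,6}, {4,7}}"

definition aug_edges :: "nat set set" where
  "aug_edges = insert {0,1} E7_edges"

definition neighbors :: "nat \<Rightarrow> nat set" where
  "neighbors v = {w. {v, w} \<in> aug_edges}"

definition labelings :: "(nat \<Rightarrow> bit) set" where
  "labelings = {1..7} \<rightarrow>\<^sub>E UNIV"

definition aug_label :: "(nat \<Rightarrow> bit) \<Rightarrow> nat \<Rightarrow> bit" where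
  "aug_label a = a(0 := 1)"

definition move :: "nat \<Rightarrow> (nat \<Rightarrow> bit) \<Rightarrow> (nat \<Rightarrow> bit)" where
  "move i a = a(i := a i + (\<Sum>j\<in>neighbors i. aug_label a j))"

definition move_step :: "((nat \<Rightarrow> bit) \<times> (nat \<Rightarrow> bit)) set" where
  "move_step = {(a, move i a) | a i. a \<in> labelings \<and> i \<in> {1..7}}"

definition move_equiv :: "((nat \<Rightarrow> bit) \<times> (nat \<Rightarrow> bit)) set" where
  "move_equiv = move_step\<^sup>* \<inter> labelings \<times> labelings"

definition orbit_of :: "(nat \<Rightarrow> bit) \<Rightarrow> (nat \<Rightarrow> bit) set" where
  "orbit_of a = move_equiv `` {a}"

definition orbits :: "(nat \<Rightarrow> bit) set set" where
  "orbits = labelings // move_equiv"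

definition support :: "(nat \<Rightarrow> bit) \<Rightarrow> nat set" where
  "support a = {v \<in> {0..7}. aug_label a v = 1}"

definition support_adj :: "(nat \<Rightarrow> bit) \<Rightarrow> (nat \<times> nat) set" where
  "support_adj a = {(v, w). v \<in> support a \<and> w \<in> support a \<and> {v, w} \<in> aug_edges}"

definition components :: "(nat \<Rightarrow> bit) \<Rightarrow> nat set set" where
  "components a = support a // ((support_adj a)\<^sup>* \<inter> support a \<times> support a)"

definition zero_labeling :: "nat \<Rightarrow> bit" where
  "zero_labeling = (\<lambda>i\<in>{1..7}. 0)"

definition rep_labeling :: "nat \<Rightarrow> bit" where
  "rep_labeling = (\<lambda>i\<in>{1..7}. if i \<in> {2, 4, 6} then 1 else 0)"

lemma finite_neighbors: "finite (neighbors v)"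
proof (rule finite_subset)
  show "neighbors v \<subseteq> \<Union>aug_edges" by (auto simp: neighbors_def)
  show "finite (\<Union>aug_edges)" by (simp add: aug_edges_def E7_edges_def)
qed

lemma move_in_labelings:
  "a \<in> labelings \<Longrightarrow> i \<in> {1..7} \<Longrightarrow> move i a \<in> labelings"
  by (auto simp: labelings_def move_def PiE_def extensional_def)

lemma move_move:
  assumes "i \<in> {1..7}"
  shows "move i (move i a) = a"
proof -
  have "i \<notin> neighbors i"
    by (auto simp: neighbors_def aug_edges_def E7_edges_def doubleton_eq_iff)
  then have "(\<Sum>j\<in>neighbors i. aug_label (move i a) j) = (\<Sum>j\<in>neighbors i. aug_label a j)"
    by (intro sum.cong) (auto simp: aug_label_def move_def)
  moreover have "x + y + y = x" for x y :: bit
    by (cases x; cases y) simp_all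
  ultimately show ?thesis
    unfolding move_def [of i "move i a"] by (simp only:) (simp only: move_def fun_upd_same fun_upd_upd fun_upd_triv)
qed

text \<open>Moves are involutions, so reachability by moves is an equivalence relation.\<close>

lemma equiv_move_equiv: "equiv labelings move_equiv"
proof -
  have "sym move_step"
    by (force simp: sym_def move_step_def intro: move_in_labelings move_move [symmetric])
  then have "sym (move_step\<^sup>*)"
    by (rule sym_rtrancl)
  then have "sym move_equiv"
    by (auto simp: move_equiv_def sym_def)
  moreover have "trans move_equiv"
    by (auto simp: move_equiv_def intro!: transI intro: rtrancl_trans)
  ultimately show ?thesis
    by (auto simp: equiv_def refl_on_def move_equiv_def)
qed

lemma equiv_support_reachability:
  "equiv (support a) ((support_adj a)\<^sup>* \<inter> support a \<times> support a)"
proof -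
  have "sym ((support_adj a)\<^sup>*)"
    by (rule sym_rtrancl) (auto simp: sym_def support_adj_def insert_commute)
  then show ?thesis
    by (auto simp: equiv_def refl_on_def sym_def intro!: transI intro: rtrancl_trans)
qed

end

theory Submission
  imports Defs
begin

text \<open>
  The augmented diagram is a tree, so the number of components of a labeling is the number of
  vertices minus the number of edges of its support. Modulo 2 this is a quadratic form in the
  labels, and every move preserves it: changing \<open>a\<^sub>i\<close> alters the form by one plus the sum of
  the neighboring labels, and the move changes \<open>a\<^sub>i\<close> only if that sum is one. Conversely,
  unless the support is \<open>{0}\<close> or \<open>{0, 2}\<close>, some word of moves decreases the sum of the
  vertices in the support, so there are at most two orbits.
\<close>

section \<open>Components and roots\<close>

text \<open>The tree is rooted at \<open>0\<close>, and each edge is indexed by its endpoint farther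
  from \<open>0\<close>. The exceptional value reflects that the branch vertex \<open>4\<close> has
  the two children \<open>5\<close> and \<open>7\<close>.\<close>

definition parent :: "nat \<Rightarrow> nat" where
  "parent v = (if v = 7 then 4 else v - 1)"

lemma vertices: "{1..7} = {1, 2, 3, 4, 5, 6, 7::nat}"
  by auto
lemma sum_vertices:
  "(\<Sum>v\<in>{1..7}. f v) = f 1 + f 2 + f 3 + f 4 + f 5 + f 6 + f (7::nat)"
  unfolding vertices by (simp add: add.assoc)

lemma parent_eq:
  "parent 1 = 0" "parent 2 = 1" "parent 3 = 2" "parent 4 = 3" "parent 5 = 4" "parent 6 = 5" "parent 7 = 4"
  by (simp_all add: parent_def)
lemma aug_edges_eq: "aug_edges = (\<lambda>v. {v, parent v}) ` {1..7}"
  unfolding vertices aug_edges_def E7_edges_def image_insert image_empty parent_eq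
  by (simp only: insert_commute)
lemma aug_edges_iff:
  "{v, w} \<in> aug_edges \<longleftrightarrow> (v \<in> {1..7} \<and> w = parent v) \<or> (w \<in> {1..7} \<and> v = parent w)"
  unfolding aug_edges_eq by (auto simp: doubleton_eq_iff)

text \<open>Climbs towards \<open>0\<close> as long as the next label is 1. For \<open>v\<close> in
  the support this ends at the vertex of its component nearest to \<open>0\<close>, a canonical
  representative.\<close>

function root :: "(nat \<Rightarrow> bit) \<Rightarrow> nat \<Rightarrow> nat" where
  "root a v = (if v = 0 \<or> aug_label a (parent v) = 0 then v else root a (parent v))"
  by auto
termination
  by (relation "measure snd") (auto simp: parent_def)

declare root.simps [simp del]

lemma parent_in_support:
  assumes "v \<in> support a" "v \<noteq> 0" "aug_label a (parent v) \<noteq> 0"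
  shows "parent v \<in> support a"
  using assms by (auto simp: support_def parent_def)

lemma root_reachable:
  assumes "v \<in> support a"
  shows "root a v \<in> support a \<and> (v, root a v) \<in> (support_adj a)\<^sup>*"
  using assms
proof (induction a v rule: root.induct)
  case (1 a v)
  show ?case
  proof (cases "v = 0 \<or> aug_label a (parent v) = 0")
    case True
    then show ?thesis
      using 1 by (simp add: root.simps [of a v])
  next
    case False
    then have parent: "parent v \<in> support a"
      using 1 parent_in_support by blast
    moreover have "(v, parent v) \<in> support_adj a"
      using 1 False parent by (auto simp: support_adj_def aug_edges_iff support_def)
    ultimately show ?thesis
      using 1 False by (auto simp: root.simps [of a v] intro: converse_rtrancl_into_rtrancl)
  qed
qed

text \<open>One of two adjacent vertices is the parent of the other, and the climb from the child
  passes through that parent.\<close>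

lemma root_eq_if_adjacent:
  assumes "(v, w) \<in> support_adj a"
  shows "root a v = root a w"
proof -
  have "root a u = root a (parent u)" if "u \<in> {1..7}" "parent u \<in> support a" for u
    using that by (simp add: root.simps [of a u] support_def)
  then show ?thesis
    using assms by (auto simp: support_adj_def aug_edges_iff)
qed

lemma root_eq_if_reachable:
  "(v, w) \<in> (support_adj a)\<^sup>* \<Longrightarrow> root a v = root a w"
  by (induction rule: rtrancl_induct) (auto dest: root_eq_if_adjacent)

lemma reachable_iff_root_eq:
  assumes "v \<in> support a" "w \<in> support a"
  shows "(v, w) \<in> (support_adj a)\<^sup>* \<longleftrightarrow> root a v = root a w"
proof
  assume "root a v = root a w"
  moreover have "sym ((support_adj a)\<^sup>*)"
    by (rule sym_rtrancl) (auto simp: sym_def support_adj_def insert_commute)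
  ultimately show "(v, w) \<in> (support_adj a)\<^sup>*"
    using root_reachable assms by (metis rtrancl_trans symD)
qed (rule root_eq_if_reachable)

text \<open>The classes are the fibres of \<open>f\<close> over its image; these are nonempty and
  disjoint, so distinct values give distinct classes.\<close>

lemma card_quotient_kernel:
  "card (S // {(x, y). x \<in> S \<and> y \<in> S \<and> f x = f y}) = card (f ` S)"
proof -
  have "S // {(x, y). x \<in> S \<and> y \<in> S \<and> f x = f y} = (\<lambda>z. {y \<in> S. f y = z}) ` f ` S"
    by (force simp: quotient_def image_iff)
  moreover have "inj_on (\<lambda>z. {y \<in> S. f y = z}) (f ` S)"
    by (auto simp: inj_on_def)
  ultimately show ?thesis
    by (simp add: card_image)
qed

text \<open>The climb stops only where there is no label 1 to move up to, and every such vertex is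
  its own root.\<close>

lemma root_image:
  "root a ` support a = {v \<in> support a. v = 0 \<or> aug_label a (parent v) = 0}"
proof
  have "root a v = 0 \<or> aug_label a (parent (root a v)) = 0" for v
  proof (induction a v rule: root.induct)
    case (1 a v)
    show ?case
    proof (cases "v = 0 \<or> aug_label a (parent v) = 0")
      case True
      then have "root a v = v"
        by (subst root.simps) simp
      then show ?thesis
        using True by simp
    next
      case False
      then have "root a v = root a (parent v)"
        by (subst root.simps) simp
      then show ?thesis
        using 1 [OF False] by simp
    qed
  qed
  then show "root a ` support a \<subseteq> {v \<in> support a. v = 0 \<or> aug_label a (parent v) = 0}"
    by (intro image_subsetI) (simp add: root_reachable)
  show "{v \<in> support a. v = 0 \<or> aug_label a (parent v) = 0} \<subseteq> root a ` support a"
  proof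
    fix v
    assume v: "v \<in> {v \<in> support a. v = 0 \<or> aug_label a (parent v) = 0}"
    then have "root a v = v"
      by (subst root.simps) simp
    then show "v \<in> root a ` support a"
      using v by (intro image_eqI [of v "root a" v]) simp_all
  qed
qed

text \<open>Components are counted by their roots. \<open>Suc\<close> accounts for the component of
  \<open>0\<close>, which always exists because the boxed label is 1.\<close>

lemma card_components:
  "card (components a) = Suc (\<Sum>v\<in>{1..7}. of_bool (a v = 1 \<and> aug_label a (parent v) = 0))"
proof -
  have "(support_adj a)\<^sup>* \<inter> support a \<times> support a =
      {(v, w). v \<in> support a \<and> w \<in> support a \<and> root a v = root a w}"
    using reachable_iff_root_eq by blast
  then have "card (components a) = card (root a ` support a)"
    by (simp add: components_def card_quotient_kernel)
  also have "root a ` support a =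
      insert 0 ({1..7} \<inter> {v. a v = 1 \<and> aug_label a (parent v) = 0})"
    unfolding root_image by (auto simp: support_def aug_label_def)
  also have "card \<dots> = Suc (\<Sum>v\<in>{1..7}. of_bool (a v = 1 \<and> aug_label a (parent v) = 0))"
    by (simp flip: sum.inter_restrict)
  finally show ?thesis .
qed


section \<open>Labelings in coordinates\<close>

text \<open>Seven explicit bits turn statements about all labelings into finite case distinctions.
  List positions start at 0, hence the shift of the index.\<close>

definition lab :: "bit \<Rightarrow> bit \<Rightarrow> bit \<Rightarrow> bit \<Rightarrow> bit \<Rightarrow> bit \<Rightarrow> bit \<Rightarrow> nat \<Rightarrow> bit" where
  "lab x1 x2 x3 x4 x5 x6 x7 = (\<lambda>i\<in>{1..7}. [x1, x2, x3, x4, x5, x6, x7] ! (i - 1))"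

lemma lab_in_labelings: "lab x1 x2 x3 x4 x5 x6 x7 \<in> labelings"
  by (simp add: lab_def labelings_def)

lemma lab_apply:
  "lab x1 x2 x3 x4 x5 x6 x7 1 = x1"
  "lab x1 x2 x3 x4 x5 x6 x7 (Suc 0) = x1"
  "lab x1 x2 x3 x4 x5 x6 x7 2 = x2"
  "lab x1 x2 x3 x4 x5 x6 x7 3 = x3"
  "lab x1 x2 x3 x4 x5 x6 x7 4 = x4"
  "lab x1 x2 x3 x4 x5 x6 x7 5 = x5"
  "lab x1 x2 x3 x4 x5 x6 x7 6 = x6"
  "lab x1 x2 x3 x4 x5 x6 x7 7 = x7"
  by (simp_all add: lab_def)

lemma aug_label_lab:
  "aug_label (lab x1 x2 x3 x4 x5 x6 x7) 0 = 1"
  "aug_label (lab x1 x2 x3 x4 x5 x6 x7) 1 = x1"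
  "aug_label (lab x1 x2 x3 x4 x5 x6 x7) 2 = x2"
  "aug_label (lab x1 x2 x3 x4 x5 x6 x7) 3 = x3"
  "aug_label (lab x1 x2 x3 x4 x5 x6 x7) 4 = x4"
  "aug_label (lab x1 x2 x3 x4 x5 x6 x7) 5 = x5"
  "aug_label (lab x1 x2 x3 x4 x5 x6 x7) 6 = x6"
  "aug_label (lab x1 x2 x3 x4 x5 x6 x7) 7 = x7"
  by (simp_all add: aug_label_def lab_apply)

lemma labelings_cases:
  assumes "a \<in> labelings"
  obtains x1 x2 x3 x4 x5 x6 x7 where "a = lab x1 x2 x3 x4 x5 x6 x7"
proof
  show "a = lab (a 1) (a 2) (a 3) (a 4) (a 5) (a 6) (a 7)"
  proof (rule extensionalityI)
    show "a \<in> extensional {1..7}"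
      using assms by (simp add: labelings_def PiE_def)
    show "lab (a 1) (a 2) (a 3) (a 4) (a 5) (a 6) (a 7) \<in> extensional {1..7}"
      by (simp add: lab_def)
    fix i :: nat
    assume "i \<in> {1..7}"
    then show "a i = lab (a 1) (a 2) (a 3) (a 4) (a 5) (a 6) (a 7) i"
      unfolding vertices by (auto simp: lab_apply)
  qed
qed

lemma neighbors_eq:
  "neighbors 1 = {0, 2}" "neighbors 2 = {1, 3}" "neighbors 3 = {2, 4}" "neighbors 4 = {3, 5, 7}"
  "neighbors 5 = {4, 6}" "neighbors 6 = {5}" "neighbors 7 = {4}"
  by (auto simp: neighbors_def aug_edges_def E7_edges_def doubleton_eq_iff)

lemma lab_upd:
  "(lab x1 x2 x3 x4 x5 x6 x7)(1 := y) = lab y x2 x3 x4 x5 x6 x7"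
  "(lab x1 x2 x3 x4 x5 x6 x7)(2 := y) = lab x1 y x3 x4 x5 x6 x7"
  "(lab x1 x2 x3 x4 x5 x6 x7)(3 := y) = lab x1 x2 y x4 x5 x6 x7"
  "(lab x1 x2 x3 x4 x5 x6 x7)(4 := y) = lab x1 x2 x3 y x5 x6 x7"
  "(lab x1 x2 x3 x4 x5 x6 x7)(5 := y) = lab x1 x2 x3 x4 y x6 x7"
  "(lab x1 x2 x3 x4 x5 x6 x7)(6 := y) = lab x1 x2 x3 x4 x5 y x7"
  "(lab x1 x2 x3 x4 x5 x6 x7)(7 := y) = lab x1 x2 x3 x4 x5 x6 y"
  unfolding lab_def vertices by (auto simp: fun_eq_iff restrict_def)

lemma move_lab:
  "move 1 (lab x1 x2 x3 x4 x5 x6 x7) = lab (x1 + (1 + x2)) x2 x3 x4 x5 x6 x7"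
  "move 2 (lab x1 x2 x3 x4 x5 x6 x7) = lab x1 (x2 + (x1 + x3)) x3 x4 x5 x6 x7"
  "move 3 (lab x1 x2 x3 x4 x5 x6 x7) = lab x1 x2 (x3 + (x2 + x4)) x4 x5 x6 x7"
  "move 4 (lab x1 x2 x3 x4 x5 x6 x7) = lab x1 x2 x3 (x4 + (x3 + (x5 + x7))) x5 x6 x7"
  "move 5 (lab x1 x2 x3 x4 x5 x6 x7) = lab x1 x2 x3 x4 (x5 + (x4 + x6)) x6 x7"
  "move 6 (lab x1 x2 x3 x4 x5 x6 x7) = lab x1 x2 x3 x4 x5 (x6 + x5) x7"
  "move 7 (lab x1 x2 x3 x4 x5 x6 x7) = lab x1 x2 x3 x4 x5 x6 (x7 + x4)"
  unfolding move_def neighbors_eq lab_upd by (simp_all add: aug_label_def lab_apply)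

lemma zero_labeling_lab: "zero_labeling = lab 0 0 0 0 0 0 0"
  unfolding zero_labeling_def lab_def vertices by (auto simp: fun_eq_iff restrict_def)

lemma rep_labeling_lab: "rep_labeling = lab 0 1 0 1 0 1 0"
  unfolding rep_labeling_def lab_def vertices by (auto simp: fun_eq_iff restrict_def)


section \<open>The invariant\<close>

text \<open>A summand is 1 exactly when \<open>v\<close> is the root of a component, so this is the
  number of components other than that of \<open>0\<close>, modulo 2.\<close>

definition form :: "(nat \<Rightarrow> bit) \<Rightarrow> bit" where
  "form a = (\<Sum>v\<in>{1..7}. a v * (1 + aug_label a (parent v)))"

lemma form_lab:
  "form (lab x1 x2 x3 x4 x5 x6 x7) =
    x2 * (1 + x1) + x3 * (1 + x2) + x4 * (1 + x3) + x5 * (1 + x4) + x6 * (1 + x5) + x7 * (1 + x4)"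
  unfolding form_def sum_vertices parent_eq aug_label_lab lab_apply by simp

lemma form_move:
  assumes "a \<in> labelings" "i \<in> {1..7}"
  shows "form (move i a) = form a"
proof -
  obtain x1 x2 x3 x4 x5 x6 x7 where a: "a = lab x1 x2 x3 x4 x5 x6 x7"
    using assms(1) by (rule labelings_cases)
  from assms(2) consider "i = 1" | "i = 2" | "i = 3" | "i = 4" | "i = 5" | "i = 6" | "i = 7"
    unfolding vertices by blast
  \<comment> \<open>Except at the branch vertex \<open>4\<close>, it suffices to split the labels at
    \<open>i\<close> and its neighbors: the remaining terms agree on both sides.\<close>
  then show ?thesis
  proof cases
    case 1
    then show ?thesis
      unfolding a by (simp only: move_lab form_lab, cases x1; cases x2) simp_all
  next
    case 2
    then show ?thesis
      unfolding a by (simp only: move_lab form_lab, cases x1; cases x2; cases x3) simp_all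
  next
    case 3
    then show ?thesis
      unfolding a by (simp only: move_lab form_lab, cases x2; cases x3; cases x4) simp_all
  next
    case 4
    then show ?thesis
      unfolding a
      by (simp only: move_lab form_lab, cases x1; cases x2; cases x3; cases x4; cases x5; cases x6; cases x7)
        simp_all
  next
    case 5
    then show ?thesis
      unfolding a by (simp only: move_lab form_lab, cases x4; cases x5; cases x6) simp_all
  next
    case 6
    then show ?thesis
      unfolding a by (simp only: move_lab form_lab, cases x5; cases x6) simp_all
  next
    case 7
    then show ?thesis
      unfolding a by (simp only: move_lab form_lab, cases x4; cases x7) simp_all
  qed
qed

lemma form_eq_if_move_equiv:
  assumes "(a, b) \<in> move_equiv"
  shows "form a = form b"
proof -
  have "(a, b) \<in> move_step\<^sup>*"
    using assms by (simp add: move_equiv_def)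
  then show ?thesis
    by (induction rule: rtrancl_induct) (auto simp: move_step_def form_move)
qed

text \<open>Parity comes from \<open>form\<close>. The bound by 4 holds since one vertex per
  component, with \<open>0\<close> for its own, is an independent set, and such a set containing
  \<open>0\<close> has at most four elements; both facts are checked on all 128 labelings.\<close>

lemma card_components_form:
  assumes "a \<in> labelings"
  shows "card (components a) \<in> {1, 3} \<longleftrightarrow> form a = 0"
    and "card (components a) \<in> {2, 4} \<longleftrightarrow> form a = 1"
proof -
  obtain x1 x2 x3 x4 x5 x6 x7 where a: "a = lab x1 x2 x3 x4 x5 x6 x7"
    using assms by (rule labelings_cases)
  have card: "card (components a) =
      Suc (of_bool (x2 = 1 \<and> x1 = 0) + of_bool (x3 = 1 \<and> x2 = 0) + of_bool (x4 = 1 \<and> x3 = 0) +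
        of_bool (x5 = 1 \<and> x4 = 0) + of_bool (x6 = 1 \<and> x5 = 0) + of_bool (x7 = 1 \<and> x4 = 0))"
    unfolding a card_components sum_vertices parent_eq aug_label_lab lab_apply by simp
  show "card (components a) \<in> {1, 3} \<longleftrightarrow> form a = 0"
    unfolding card unfolding a form_lab
    by (cases x1; cases x2; cases x3; cases x4; cases x5; cases x6; cases x7) simp_all
  show "card (components a) \<in> {2, 4} \<longleftrightarrow> form a = 1"
    unfolding card unfolding a form_lab
    by (cases x1; cases x2; cases x3; cases x4; cases x5; cases x6; cases x7) simp_all
qed


section \<open>Reduction to two labelings\<close>

text \<open>Counting each vertex with its number makes sliding a label towards \<open>0\<close> a
  decrease, although the size of the support stays the same.\<close>

definition weight :: "(nat \<Rightarrow> bit) \<Rightarrow> nat" where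
  "weight a = (\<Sum>v\<in>{1..7}. if a v = 1 then v else 0)"

lemma weight_lab:
  "weight (lab x1 x2 x3 x4 x5 x6 x7) =
    (if x1 = 1 then 1 else 0) + (if x2 = 1 then 2 else 0) + (if x3 = 1 then 3 else 0) +
    (if x4 = 1 then 4 else 0) + (if x5 = 1 then 5 else 0) + (if x6 = 1 then 6 else 0) +
    (if x7 = 1 then 7 else 0)"
  unfolding weight_def sum_vertices lab_apply by (rule refl)

text \<open>
  A component with an edge has a leaf other than \<open>0\<close>, which a single move removes. If no such
  leaf exists, the support is an independent set: words of length two slide an isolated vertex
  towards \<open>0\<close>, and the two long words, found by search, take the supports \<open>{0, 2, 4, 6}\<close> to
  \<open>{0, 2}\<close> and \<open>{0, 2, 4}\<close> to \<open>{0}\<close>.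
\<close>

definition reducing_words :: "nat list list" where
  "reducing_words =
    [[1], [2], [3], [4], [5], [6], [7], [2, 3], [3, 4], [4, 5], [5, 6], [4, 7],
     [7, 4, 5, 3, 4, 7, 6, 5, 4, 3],
     [5, 4, 3, 2, 1, 6, 5, 4, 3, 2, 7, 4, 3, 5, 4, 6, 5, 7, 4, 3, 2, 1]]"

lemma reducing_words_decrease:
  assumes "a \<in> labelings" "a \<noteq> lab 0 0 0 0 0 0 0" "a \<noteq> lab 0 1 0 0 0 0 0"
  shows "\<exists>w\<in>set reducing_words. weight (fold move w a) < weight a"
proof -
  obtain x1 x2 x3 x4 x5 x6 x7 where a: "a = lab x1 x2 x3 x4 x5 x6 x7"
    using assms(1) by (rule labelings_cases)
  have "a = lab 0 0 0 0 0 0 0 \<or> a = lab 0 1 0 0 0 0 0 \<or>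
      (\<exists>w\<in>set reducing_words. weight (fold move w a) < weight a)"
    unfolding a reducing_words_def
    by (cases x1; cases x2; cases x3; cases x4; cases x5; cases x6; cases x7)
      \<comment> \<open>The simplifier turns the letter \<open>1\<close> of a word into
        \<open>Suc 0\<close>, so the rules for moves must have that form too.\<close>
      (simp_all add: move_lab [unfolded One_nat_def] weight_lab)
  then show ?thesis
    using assms(2,3) by blast
qed

lemma move_equiv_fold_move:
  assumes "a \<in> labelings" "set w \<subseteq> {1..7}"
  shows "(a, fold move w a) \<in> move_equiv"
  using assms
proof (induction w arbitrary: a)
  case Nil
  then show ?case
    by (simp add: move_equiv_def)
next
  case (Cons i w)
  then have "(move i a, fold move w (move i a)) \<in> move_equiv"
    by (simp add: move_in_labelings)
  moreover have "(a, move i a) \<in> move_step"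
    using Cons.prems by (auto simp: move_step_def)
  ultimately show ?case
    using Cons.prems(1) by (auto simp: move_equiv_def intro: converse_rtrancl_into_rtrancl)
qed

lemma move_equiv_normal_form:
  assumes "a \<in> labelings"
  shows "(a, lab 0 0 0 0 0 0 0) \<in> move_equiv \<or> (a, lab 0 1 0 0 0 0 0) \<in> move_equiv"
  using assms
proof (induction "weight a" arbitrary: a rule: less_induct)
  case less
  show ?case
  proof (cases "a = lab 0 0 0 0 0 0 0 \<or> a = lab 0 1 0 0 0 0 0")
    case True
    then show ?thesis
      using less.prems by (auto simp: move_equiv_def)
  next
    case False
    then obtain w where w: "w \<in> set reducing_words" "weight (fold move w a) < weight a"
      using reducing_words_decrease less.prems by blast
    have "set w \<subseteq> {1..7}"
      using w(1) by (auto simp: reducing_words_def)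
    then have equiv: "(a, fold move w a) \<in> move_equiv"
      using less.prems by (rule move_equiv_fold_move [rotated])
    then have "fold move w a \<in> labelings"
      by (simp add: move_equiv_def)
    then show ?thesis
      using less.hyps [OF w(2)] equiv equiv_move_equiv by (meson equivE transD)
  qed
qed

text \<open>The two normal forms differ in the value of \<open>form\<close>, so this invariant
  decides which of them a labeling reaches; labelings with equal values meet in the same
  one.\<close>

lemma move_equiv_iff_form_eq:
  assumes "a \<in> labelings" "b \<in> labelings"
  shows "(a, b) \<in> move_equiv \<longleftrightarrow> form a = form b"
proof
  assume eq: "form a = form b"
  have "\<exists>c. (a, c) \<in> move_equiv \<and> (b, c) \<in> move_equiv"
  proof (cases "form a = 0")
    case True
    then have "form c = 0 \<Longrightarrow> c \<in> labelings \<Longrightarrow> (c, lab 0 0 0 0 0 0 0) \<in> move_equiv" for c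
      using move_equiv_normal_form [of c]
        form_eq_if_move_equiv [of c "lab 0 1 0 0 0 0 0"] by (auto simp: form_lab)
    then show ?thesis
      using True eq assms by metis
  next
    case False
    then have "form c \<noteq> 0 \<Longrightarrow> c \<in> labelings \<Longrightarrow> (c, lab 0 1 0 0 0 0 0) \<in> move_equiv" for c
      using move_equiv_normal_form [of c]
        form_eq_if_move_equiv [of c "lab 0 0 0 0 0 0 0"] by (auto simp: form_lab)
    then show ?thesis
      using False eq assms by metis
  qed
  then show "(a, b) \<in> move_equiv"
    using equiv_move_equiv by (meson equivE symD transD)
qed (rule form_eq_if_move_equiv)

lemma orbit_of_eq_form_fibre:
  assumes "a \<in> labelings"
  shows "orbit_of a = {b \<in> labelings. form b = form a}"
  using assms move_equiv_iff_form_eq [OF assms]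
  by (auto simp: orbit_of_def move_equiv_def)

theorem proposition12p5:
  shows "card orbits = 2 \<and>
         orbits = {orbit_of zero_labeling, orbit_of rep_labeling} \<and>
         orbit_of zero_labeling = {a \<in> labelings. card (components a) \<in> {1, 3}} \<and>
         orbit_of rep_labeling = {a \<in> labelings. card (components a) \<in> {2, 4}}"
proof -
  have zero: "zero_labeling \<in> labelings" "form zero_labeling = 0"
    by (simp_all only: zero_labeling_lab lab_in_labelings form_lab) simp
  \<comment> \<open>The representative is not the normal form with support \<open>{0, 2}\<close>,
    but the two have the same value of \<open>form\<close> and hence the same orbit.\<close>
  have rep: "rep_labeling \<in> labelings" "form rep_labeling = 1"
    by (simp_all only: rep_labeling_lab lab_in_labelings form_lab) simp
  have orbit_zero: "orbit_of zero_labeling = {a \<in> labelings. form a = 0}"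
    and orbit_rep: "orbit_of rep_labeling = {a \<in> labelings. form a = 1}"
    by (simp_all only: orbit_of_eq_form_fibre zero rep)
  have orbits: "orbits = {orbit_of zero_labeling, orbit_of rep_labeling}"
  proof -
    have "orbits = orbit_of ` labelings"
      by (auto simp: orbits_def quotient_def orbit_of_def)
    also have "\<dots> = {orbit_of zero_labeling, orbit_of rep_labeling}"
    proof (intro subset_antisym image_subsetI)
      fix a
      assume a: "a \<in> labelings"
      show "orbit_of a \<in> {orbit_of zero_labeling, orbit_of rep_labeling}"
        \<comment> \<open>A bit has only two values, so every orbit is one of the two
          fibres.\<close>
        unfolding orbit_of_eq_form_fibre [OF a] orbit_zero orbit_rep
        by (cases "form a") simp_all
    qed (use zero(1) rep(1) in simp)
    finally show ?thesis .
  qed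
  have "zero_labeling \<in> orbit_of zero_labeling" "zero_labeling \<notin> orbit_of rep_labeling"
    unfolding orbit_zero orbit_rep using zero by simp_all
  then have "orbit_of zero_labeling \<noteq> orbit_of rep_labeling"
    by metis
  then have "card orbits = 2"
    unfolding orbits by simp
  moreover have "orbit_of zero_labeling = {a \<in> labelings. card (components a) \<in> {1, 3}}"
    unfolding orbit_zero by (simp only: card_components_form(1) cong: conj_cong)
  moreover have "orbit_of rep_labeling = {a \<in> labelings. card (components a) \<in> {2, 4}}"
    unfolding orbit_rep by (simp only: card_components_form(2) cong: conj_cong)
  ultimately show ?thesis
    using orbits by (intro conjI)
qed

end
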